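(* Define integers $b(n,k)$, for integers $n\ge 1$ and $k\le n+1$, recursively by $$b(n,k)=\begin{cases} 0 & k<2,\\ 1 & k=2 \text{ and } n\in\{1,2\},\\ 2 & n=2 \text{ and } k=3,\\ 2b(n-1,k-1)+\displaystyle\sum_{j=k-1}^{n-1}b(n-2,j) & \text{otherwise}, \end{cases}$$ where a sum whose lower limit exceeds its upper limit is $0$. Then for every integer $n\ge 1$, $$\mathrm{pf}_n(123,132)=\sum_{k=2}^{n+1}b(n,k).$$
   Context: A Dyck path of semilength $n$ is a lattice path from $(0,0)$ to $(n,n)$ consisting of $n$ north steps $N=(0,1)$ and $n$ east steps $E=(1,0)$ that never goes below the line $y=x$. A parking function of size $n$ is a Dyck path of semilength $n$ whose $n$ north steps are labeled bijectively by $\{1,\dots,n\}$ so that whenever two north steps are consecutive in the path (one immediately following the other), the label of the later one is larger. For a parking function $p$ of size $n$, $\phi(p)$ is the permutation of $\{1,\dots,n\}$ (in one-line notation) obtained by reading the labels of the north steps in the order they occur along the path. A permutation $\pi$ of $\{1,\dots,n\}$ contains a permutation $\rho$ of $\{1,\dots,m\}$ if there are indices $1\le i_1<\cdots<i_m\le n$ such that $\pi_{i_a}\le\pi_{i_b}$ if and only if $\rho_a\le\rho_b$; otherwise $\pi$ avoids $\rho$. For permutations $\rho_1,\dots,\rho_r$, $\mathrm{pf}_n(\rho_1,\dots,\rho_r)$ denotes the number of parking functions $p$ of size $n$ such that $\phi(p)$ avoids each of $\rho_1,\dots,\rho_r$. *)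

theory Defs
  imports "HOL-Combinatorics.Multiset_Permutations"
begin

datatype step = North | East

text \<open>After the first \<open>i\<close> steps the path is at the point whose coordinates are the number of
  east steps and the number of north steps among them.\<close>

definition dyck_path :: "nat \<Rightarrow> step list \<Rightarrow> bool" where
  "dyck_path n w \<longleftrightarrow>
     count_list w North = n \<and> count_list w East = n \<and>
     (\<forall>i\<le>length w. count_list (take i w) East \<le> count_list (take i w) North)"

datatype lstep = LNorth nat | LEast

primrec unlabel :: "lstep \<Rightarrow> step" where
  "unlabel (LNorth l) = North"
| "unlabel LEast = East"

primrec phi :: "lstep list \<Rightarrow> nat list" where
  "phi [] = []"
| "phi (s # p) = (case s of LNorth l \<Rightarrow> l # phi p | LEast \<Rightarrow> phi p)"

definition parking_function :: "nat \<Rightarrow> lstep list \<Rightarrow> bool" where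
  "parking_function n p \<longleftrightarrow>
     dyck_path n (map unlabel p) \<and>
     phi p \<in> permutations_of_set {1..n} \<and>
     (\<forall>i k l. Suc i < length p \<and> p ! i = LNorth k \<and> p ! Suc i = LNorth l \<longrightarrow> k < l)"

text \<open>Permutations are lists in one-line notation; positions are counted from 0.\<close>

definition contains :: "nat list \<Rightarrow> nat list \<Rightarrow> bool" where
  "contains \<pi> \<rho> \<longleftrightarrow>
     (\<exists>f. strict_mono_on {..<length \<rho>} f \<and>
          (\<forall>a<length \<rho>. f a < length \<pi>) \<and>
          (\<forall>a<length \<rho>. \<forall>b<length \<rho>. \<pi> ! f a \<le> \<pi> ! f b \<longleftrightarrow> \<rho> ! a \<le> \<rho> ! b))"

definition avoids :: "nat list \<Rightarrow> nat list \<Rightarrow> bool" where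
  "avoids \<pi> \<rho> \<longleftrightarrow> \<not> contains \<pi> \<rho>"

definition pf :: "nat \<Rightarrow> nat list list \<Rightarrow> nat" where
  "pf n \<rho>s = card {p. parking_function n p \<and> (\<forall>\<rho>\<in>set \<rho>s. avoids (phi p) \<rho>)}"

lemma label_in_phi: "LNorth l \<in> set p \<Longrightarrow> l \<in> set (phi p)"
  by (induction p) (auto split: lstep.splits)

lemma count_North_East: "count_list w North + count_list w East = length w"
proof (induction w)
  case (Cons s w)
  then show ?case by (cases s) auto
qed simp

lemma finite_parking_functions: "finite {p. parking_function n p}"
proof (rule finite_subset)
  let ?A = "insert LEast (LNorth ` {1..n})"
  show "{p. parking_function n p} \<subseteq> {p. set p \<subseteq> ?A \<and> length p = 2 * n}"
  proof (intro subsetI CollectI conjI)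
    fix p assume "p \<in> {p. parking_function n p}"
    then have p: "parking_function n p" by simp
    then have "set (phi p) = {1..n}"
      by (simp add: parking_function_def permutations_of_set_def)
    then have labels: "l \<in> {1..n}" if "LNorth l \<in> set p" for l
      using label_in_phi[OF that] by simp
    show "s \<in> ?A" if "s \<in> set p" for s
    proof (cases s)
      case (LNorth l)
      with that labels show ?thesis by blast
    qed simp
    show "length p = 2 * n"
      using p count_North_East[of "map unlabel p"]
      by (simp add: parking_function_def dyck_path_def)
  qed
  show "finite {p. set p \<subseteq> ?A \<and> length p = 2 * n}"
    by (rule finite_lists_length_eq) simp
qed

text \<open>The numbers \<open>b(n,k)\<close> are only specified for \<open>n \<ge> 1\<close> and \<open>k \<le> n + 1\<close>. The first clause
  gives a dummy value outside that domain; for arguments inside it, the recursion never leaves it.\<close>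

function b :: "nat \<Rightarrow> int \<Rightarrow> int" where
  "b n k =
    (if n = 0 \<or> k > int n + 1 then 0
     else if k < 2 then 0
     else if k = 2 \<and> n \<in> {1, 2} then 1
     else if n = 2 \<and> k = 3 then 2
     else 2 * b (n - 1) (k - 1) + (\<Sum>j = k - 1..int n - 1. b (n - 2) j))"
  by pat_completeness auto
termination by (relation "measure fst") auto

declare b.simps [simp del]

end

theory Submission
  imports Defs
begin

text \<open>A permutation avoids 123 and 132 iff no entry is followed by two larger ones, so each entry is
  the largest or the second largest of the labels not yet used. Reading a parking function step by
  step, the number \<open>W m h\<close> of ways to finish from height \<open>h\<close> above the diagonal with \<open>m\<close> labels left,
  just after an east step, therefore depends only on \<open>m\<close> and \<open>h\<close>, and for \<open>m \<ge> 3\<close>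
  \<open>W m h = W m (h - 1) + 2 * W (m - 1) h + W (m - 2) (h + 1)\<close>, where \<open>W m (-1) = 0\<close>.
  By Pascal's rule and the hockey-stick identity,
  \<open>W m h = (\<Sum>k. b m k * (h + k - 1 choose h))\<close> satisfies the same recurrence; take \<open>h = 0\<close>.\<close>

section \<open>Valid completions of a labeled path\<close>

text \<open>\<open>R\<close> is the set of unused labels, \<open>h\<close> the current height above the diagonal, and a north step
  taken next needs a label above \<open>q\<close>; as labels are positive, \<open>q = 0\<close> means no constraint.\<close>

fun valid :: "nat set \<Rightarrow> nat \<Rightarrow> nat \<Rightarrow> lstep list \<Rightarrow> bool" where
  "valid R h q [] \<longleftrightarrow> R = {} \<and> h = 0"
| "valid R h q (LEast # p) \<longleftrightarrow> h > 0 \<and> valid R (h - 1) 0 p"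
| "valid R h q (LNorth l # p) \<longleftrightarrow>
     l \<in> R \<and> q < l \<and> card {x \<in> R. l < x} \<le> 1 \<and> valid (R - {l}) (Suc h) l p"

text \<open>This and the next two functions are step-by-step forms of the path, labeling and
  avoidance conditions, so that \<open>valid\<close> splits into them by a single induction.\<close>

fun above_diagonal :: "nat \<Rightarrow> step list \<Rightarrow> bool" where
  "above_diagonal h [] \<longleftrightarrow> h = 0"
| "above_diagonal h (North # w) \<longleftrightarrow> above_diagonal (Suc h) w"
| "above_diagonal h (East # w) \<longleftrightarrow> h > 0 \<and> above_diagonal (h - 1) w"

fun increasing_runs :: "nat \<Rightarrow> lstep list \<Rightarrow> bool" where
  "increasing_runs q [] \<longleftrightarrow> True"
| "increasing_runs q (LEast # p) \<longleftrightarrow> increasing_runs 0 p"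
| "increasing_runs q (LNorth l # p) \<longleftrightarrow> q < l \<and> increasing_runs l p"

fun few_larger_after :: "nat list \<Rightarrow> bool" where
  "few_larger_after [] \<longleftrightarrow> True"
| "few_larger_after (x # xs) \<longleftrightarrow> card {y \<in> set xs. x < y} \<le> 1 \<and> few_larger_after xs"

lemma all_le_Suc_shift: "(\<forall>i\<le>Suc n. P i) \<longleftrightarrow> P 0 \<and> (\<forall>i\<le>n. P (Suc i))"
  by (metis Suc_le_mono not0_implies_Suc zero_le)

lemma all_nat_split: "(\<forall>i::nat. P i) \<longleftrightarrow> P 0 \<and> (\<forall>i. P (Suc i))"
  by (metis not0_implies_Suc)

lemma above_diagonal_iff:
  "above_diagonal h w \<longleftrightarrow> h + count_list w North = count_list w East \<and>
     (\<forall>i\<le>length w. count_list (take i w) East \<le> h + count_list (take i w) North)"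
proof (induction h w rule: above_diagonal.induct)
  case (2 h w)
  then show ?case by (simp add: all_le_Suc_shift)
next
  case (3 h w)
  show ?case
  proof (cases h)
    case 0
    then show ?thesis by (auto simp: all_le_Suc_shift)
  next
    case (Suc h')
    with 3 show ?thesis by (simp add: all_le_Suc_shift)
  qed
qed auto

text \<open>The bound is reset to 0 after an east step, and with positive labels this imposes
  nothing on the next north step.\<close>

lemma increasing_runs_iff:
  assumes "0 \<notin> set (phi p)"
  shows "increasing_runs q p \<longleftrightarrow>
    (\<forall>l p'. p = LNorth l # p' \<longrightarrow> q < l) \<and>
    (\<forall>i k l. Suc i < length p \<and> p ! i = LNorth k \<and> p ! Suc i = LNorth l \<longrightarrow> k < l)"
  using assms
proof (induction q p rule: increasing_runs.induct)
  case (2 q p)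
  have "(\<forall>i k l. Suc i < length (LEast # p) \<and> (LEast # p) ! i = LNorth k \<and>
          (LEast # p) ! Suc i = LNorth l \<longrightarrow> k < l) \<longleftrightarrow>
        (\<forall>i k l. Suc i < length p \<and> p ! i = LNorth k \<and> p ! Suc i = LNorth l \<longrightarrow> k < l)"
    by (subst all_nat_split) auto
  moreover have "\<forall>l p'. p = LNorth l # p' \<longrightarrow> 0 < l"
    using 2 by auto
  ultimately show ?case using 2 by simp
next
  case (3 q l p)
  \<comment> \<open>Index 0 compares \<open>l\<close> with the head of \<open>p\<close>; the later
    indices are the adjacent pairs inside \<open>p\<close>.\<close>
  have "(\<forall>i k m. Suc i < length (LNorth l # p) \<and> (LNorth l # p) ! i = LNorth k \<and>
          (LNorth l # p) ! Suc i = LNorth m \<longrightarrow> k < m) \<longleftrightarrow>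
        (\<forall>m p'. p = LNorth m # p' \<longrightarrow> l < m) \<and>
        (\<forall>i k l. Suc i < length p \<and> p ! i = LNorth k \<and> p ! Suc i = LNorth l \<longrightarrow> k < l)"
    by (subst all_nat_split) (cases p; auto)
  then show ?case using 3 by simp
qed simp

lemma valid_iff:
  assumes "0 \<notin> R"
  shows "valid R h q p \<longleftrightarrow> above_diagonal h (map unlabel p) \<and> distinct (phi p) \<and> set (phi p) = R \<and>
    increasing_runs q p \<and> few_larger_after (phi p)"
  using assms
proof (induction R h q p rule: valid.induct)
  case (3 R h q l p)
  have IH: "valid (R - {l}) (Suc h) l p \<longleftrightarrow> above_diagonal (Suc h) (map unlabel p) \<and>
      distinct (phi p) \<and> set (phi p) = R - {l} \<and> increasing_runs l p \<and> few_larger_after (phi p)"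
    using 3 by simp
  have set: "set (phi (LNorth l # p)) = R \<and> distinct (phi (LNorth l # p)) \<longleftrightarrow>
      l \<in> R \<and> set (phi p) = R - {l} \<and> distinct (phi p)"
    by auto
  have "few_larger_after (phi (LNorth l # p)) \<longleftrightarrow>
      card {x \<in> R. l < x} \<le> 1 \<and> few_larger_after (phi p)" if "set (phi p) = R - {l}"
  proof -
    \<comment> \<open>The labels read later are \<open>R - {l}\<close>, and \<open>l\<close> is not
      larger than itself.\<close>
    have "{x \<in> set (phi p). l < x} = {x \<in> R. l < x}" using that by auto
    then show ?thesis by simp
  qed
  moreover have "above_diagonal h (map unlabel (LNorth l # p)) \<longleftrightarrow> above_diagonal (Suc h) (map unlabel p)"
    by simp
  ultimately show ?case
    unfolding valid.simps IH increasing_runs.simps using set by blast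
qed auto

section \<open>Avoiding 123 and 132\<close>

text \<open>An increasing map on three positions is the list of its values, so
  \<open>(!) [i, j, k]\<close> replaces \<open>f\<close>.\<close>

lemma contains_3_iff:
  assumes "\<rho> = [r0, r1, r2]"
  shows "contains \<pi> \<rho> \<longleftrightarrow> (\<exists>i j k. i < j \<and> j < k \<and> k < length \<pi> \<and>
    (\<forall>a<3. \<forall>b<3. \<pi> ! ([i, j, k] ! a) \<le> \<pi> ! ([i, j, k] ! b) \<longleftrightarrow> \<rho> ! a \<le> \<rho> ! b))"
proof
  assume "contains \<pi> \<rho>"
  then obtain f where f: "strict_mono_on {..<3} f" "\<forall>a<3. f a < length \<pi>"
      "\<forall>a<3. \<forall>b<3. \<pi> ! f a \<le> \<pi> ! f b \<longleftrightarrow> \<rho> ! a \<le> \<rho> ! b"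
    using assms by (auto simp: contains_def numeral_3_eq_3)
  have "f 0 < f 1" "f 1 < f 2"
    using f(1) by (auto simp: strict_mono_on_def)
  moreover have "[f 0, f 1, f 2] ! a = f a" if "a < 3" for a
    using that by (auto simp: less_Suc_eq numeral_3_eq_3 numeral_2_eq_2)
  ultimately show "\<exists>i j k. i < j \<and> j < k \<and> k < length \<pi> \<and>
    (\<forall>a<3. \<forall>b<3. \<pi> ! ([i, j, k] ! a) \<le> \<pi> ! ([i, j, k] ! b) \<longleftrightarrow> \<rho> ! a \<le> \<rho> ! b)"
    using f(2,3) by (intro exI[of _ "f 0"] exI[of _ "f 1"] exI[of _ "f 2"]) simp
next
  assume "\<exists>i j k. i < j \<and> j < k \<and> k < length \<pi> \<and>
    (\<forall>a<3. \<forall>b<3. \<pi> ! ([i, j, k] ! a) \<le> \<pi> ! ([i, j, k] ! b) \<longleftrightarrow> \<rho> ! a \<le> \<rho> ! b)"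
  then obtain i j k where *: "i < j" "j < k" "k < length \<pi>"
    "\<forall>a<3. \<forall>b<3. \<pi> ! ([i, j, k] ! a) \<le> \<pi> ! ([i, j, k] ! b) \<longleftrightarrow> \<rho> ! a \<le> \<rho> ! b" by blast
  have "strict_mono_on {..<3} ((!) [i, j, k])"
    using *(1,2) by (auto simp: strict_mono_on_def less_Suc_eq numeral_3_eq_3)
  moreover have "\<forall>a<3. [i, j, k] ! a < length \<pi>"
    using *(1-3) by (auto simp: less_Suc_eq numeral_3_eq_3)
  moreover have "length \<rho> = 3" using assms by simp
  ultimately show "contains \<pi> \<rho>"
    unfolding contains_def using *(4) by metis
qed

lemma all_less_3: "(\<forall>a<3. P a) \<longleftrightarrow> P 0 \<and> P 1 \<and> P (2::nat)"
  by (auto simp: less_Suc_eq numeral_3_eq_3 numeral_2_eq_2)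

text \<open>Both patterns start with their smallest entry, and together they allow either order of
  the two larger ones; distinctness rules out a tie between these.\<close>

lemma avoids_123_132_iff:
  assumes "distinct \<pi>"
  shows "avoids \<pi> [1, 2, 3] \<and> avoids \<pi> [1, 3, 2] \<longleftrightarrow>
    \<not> (\<exists>i j k. i < j \<and> j < k \<and> k < length \<pi> \<and> \<pi> ! i < \<pi> ! j \<and> \<pi> ! i < \<pi> ! k)"
proof -
  have neq: "\<pi> ! j \<noteq> \<pi> ! k" if "j < k" "k < length \<pi>" for j k
    using that assms by (simp add: nth_eq_iff_index_eq)
  have "(\<forall>a<3. \<forall>b<3. \<pi> ! ([i, j, k] ! a) \<le> \<pi> ! ([i, j, k] ! b) \<longleftrightarrow>
        [1, 2, 3] ! a \<le> ([1, 2, 3] ! b :: nat)) \<longleftrightarrow> \<pi> ! i < \<pi> ! j \<and> \<pi> ! j < \<pi> ! k" for i j k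
    unfolding all_less_3 by simp linarith
  then have "contains \<pi> [1, 2, 3] \<longleftrightarrow>
      (\<exists>i j k. i < j \<and> j < k \<and> k < length \<pi> \<and> \<pi> ! i < \<pi> ! j \<and> \<pi> ! j < \<pi> ! k)"
    unfolding contains_3_iff[OF refl] by simp
  moreover have "(\<forall>a<3. \<forall>b<3. \<pi> ! ([i, j, k] ! a) \<le> \<pi> ! ([i, j, k] ! b) \<longleftrightarrow>
        [1, 3, 2] ! a \<le> ([1, 3, 2] ! b :: nat)) \<longleftrightarrow> \<pi> ! i < \<pi> ! k \<and> \<pi> ! k < \<pi> ! j" for i j k
    unfolding all_less_3 by simp linarith
  then have "contains \<pi> [1, 3, 2] \<longleftrightarrow>
      (\<exists>i j k. i < j \<and> j < k \<and> k < length \<pi> \<and> \<pi> ! i < \<pi> ! k \<and> \<pi> ! k < \<pi> ! j)"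
    unfolding contains_3_iff[OF refl] by simp
  ultimately show ?thesis
    unfolding avoids_def by (meson less_trans neq linorder_neqE_nat)
qed

text \<open>In a distinct list, two positions with larger entries are the same as two larger values.
  A triple of positions either starts at the head or lies in the tail.\<close>

lemma few_larger_after_iff:
  assumes "distinct xs"
  shows "few_larger_after xs \<longleftrightarrow>
    \<not> (\<exists>i j k. i < j \<and> j < k \<and> k < length xs \<and> xs ! i < xs ! j \<and> xs ! i < xs ! k)"
  using assms
proof (induction xs)
  case (Cons x xs)
  have "card {y \<in> set xs. x < y} \<le> 1 \<longleftrightarrow>
      \<not> (\<exists>j k. j < k \<and> k < length xs \<and> x < xs ! j \<and> x < xs ! k)"
  proof
    assume le: "card {y \<in> set xs. x < y} \<le> 1"
    show "\<not> (\<exists>j k. j < k \<and> k < length xs \<and> x < xs ! j \<and> x < xs ! k)"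
    proof (intro notI, elim exE conjE)
      fix j k assume jk: "j < k" "k < length xs" "x < xs ! j" "x < xs ! k"
      then have "{xs ! j, xs ! k} \<subseteq> {y \<in> set xs. x < y}" by auto
      then have "card {xs ! j, xs ! k} \<le> 1"
        using le card_mono[of "{y \<in> set xs. x < y}" "{xs ! j, xs ! k}"] by simp
      with jk Cons.prems show False by (simp add: nth_eq_iff_index_eq)
    qed
  next
    assume none: "\<not> (\<exists>j k. j < k \<and> k < length xs \<and> x < xs ! j \<and> x < xs ! k)"
    have "y = z" if y: "y \<in> set xs" "x < y" and z: "z \<in> set xs" "x < z" for y z
    proof -
      obtain j k where "j < length xs" "y = xs ! j" "k < length xs" "z = xs ! k"
        using y z by (auto simp: in_set_conv_nth)
      with none y z show ?thesis by (cases j k rule: linorder_cases) auto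
    qed
    then show "card {y \<in> set xs. x < y} \<le> 1"
      using card_le_Suc0_iff_eq[of "{y \<in> set xs. x < y}"] by simp
  qed
  moreover have "(\<exists>i j k. i < j \<and> j < k \<and> k < length (x # xs) \<and>
        (x # xs) ! i < (x # xs) ! j \<and> (x # xs) ! i < (x # xs) ! k) \<longleftrightarrow>
      (\<exists>j k. j < k \<and> k < length xs \<and> x < xs ! j \<and> x < xs ! k) \<or>
      (\<exists>i j k. i < j \<and> j < k \<and> k < length xs \<and> xs ! i < xs ! j \<and> xs ! i < xs ! k)"
    (is "?L \<longleftrightarrow> ?A \<or> ?B")
  proof
    assume ?L
    then obtain i j k where *: "i < j" "j < k" "k < length (x # xs)"
      "(x # xs) ! i < (x # xs) ! j" "(x # xs) ! i < (x # xs) ! k" by blast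
    then obtain j' k' where "j = Suc j'" "k = Suc k'"
      by (metis Suc_pred gr0I not_less_zero)
    with * show "?A \<or> ?B" by (cases i) auto
  next
    assume "?A \<or> ?B"
    then show ?L
    proof
      assume ?A
      then obtain j k where "j < k" "k < length xs" "x < xs ! j" "x < xs ! k" by blast
      then show ?L by (intro exI[of _ 0] exI[of _ "Suc j"] exI[of _ "Suc k"]) simp
    next
      assume ?B
      then obtain i j k where "i < j" "j < k" "k < length xs" "xs ! i < xs ! j" "xs ! i < xs ! k"
        by blast
      then show ?L by (intro exI[of _ "Suc i"] exI[of _ "Suc j"] exI[of _ "Suc k"]) simp
    qed
  qed
  ultimately show ?case using Cons by auto
qed simp

section \<open>Avoiding parking functions as valid paths\<close>

lemma length_phi: "length (phi p) = count_list (map unlabel p) North"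
  by (induction p) (auto split: lstep.splits)

lemma parking_function_avoiding_iff:
  "parking_function n p \<and> avoids (phi p) [1, 2, 3] \<and> avoids (phi p) [1, 3, 2] \<longleftrightarrow>
    valid {1..n} 0 0 p"
proof (cases "distinct (phi p) \<and> set (phi p) = {1..n}")
  case True
  \<comment> \<open>Being a permutation of \<open>{1..n}\<close> fixes the number of north steps;
    ending at height 0 then forces \<open>n\<close> east steps.\<close>
  then have n: "count_list (map unlabel p) North = n"
    using length_phi[of p] distinct_card[of "phi p"] by simp
  have nz: "0 \<notin> set (phi p)" "(0::nat) \<notin> {1..n}"
    using True by auto
  have perm: "phi p \<in> permutations_of_set {1..n}"
    using True by (simp add: permutations_of_set_def)
  have "dyck_path n (map unlabel p) \<longleftrightarrow> above_diagonal 0 (map unlabel p)"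
    unfolding dyck_path_def above_diagonal_iff using n by auto
  moreover have "(\<forall>i k l. Suc i < length p \<and> p ! i = LNorth k \<and> p ! Suc i = LNorth l \<longrightarrow> k < l)
      \<longleftrightarrow> increasing_runs 0 p"
  proof -
    have "\<forall>l p'. p = LNorth l # p' \<longrightarrow> 0 < l" using nz(1) by fastforce
    then show ?thesis unfolding increasing_runs_iff[OF nz(1)] by simp
  qed
  moreover have "avoids (phi p) [1, 2, 3] \<and> avoids (phi p) [1, 3, 2] \<longleftrightarrow> few_larger_after (phi p)"
    using True by (simp only: avoids_123_132_iff few_larger_after_iff)
  ultimately show ?thesis
    unfolding parking_function_def valid_iff[OF nz(2)] using True perm by blast
next
  case False
  have "(0::nat) \<notin> {1..n}" by simp
  from valid_iff[OF this] False have "\<not> valid {1..n} 0 0 p" by blast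
  moreover have "\<not> parking_function n p"
    using False unfolding parking_function_def permutations_of_set_def by blast
  ultimately show ?thesis by blast
qed

section \<open>Counting valid completions\<close>

definition completions :: "nat set \<Rightarrow> nat \<Rightarrow> nat \<Rightarrow> lstep list set" where
  "completions R h q = {p. valid R h q p}"

lemma finite_completions:
  assumes "finite R"
  shows "finite (completions R h q)"
proof (rule finite_subset)
  have "set p \<subseteq> insert LEast (LNorth ` R) \<and> length p \<le> 2 * card R + h" if "valid R h q p" for p
    using that assms
  proof (induction R h q p rule: valid.induct)
    case (3 R h q l p)
    moreover have "card R > 0" using 3 by (auto simp: card_gt_0_iff)
    ultimately show ?case by auto
  qed auto
  then show "completions R h q \<subseteq>
      {p. set p \<subseteq> insert LEast (LNorth ` R) \<and> length p \<le> 2 * card R + h}"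
    by (auto simp: completions_def)
  show "finite {p. set p \<subseteq> insert LEast (LNorth ` R) \<and> length p \<le> 2 * card R + h}"
    using assms by (intro finite_lists_length_le) simp
qed

lemma completions_unfold:
  assumes "R \<noteq> {}"
  shows "completions R h q =
    (if h = 0 then {} else (#) LEast ` completions R (h - 1) 0) \<union>
    (\<Union>l \<in> {l \<in> R. q < l \<and> card {x \<in> R. l < x} \<le> 1}.
       (#) (LNorth l) ` completions (R - {l}) (Suc h) l)"
proof (intro set_eqI)
  fix p
  show "p \<in> completions R h q \<longleftrightarrow> p \<in>
    (if h = 0 then {} else (#) LEast ` completions R (h - 1) 0) \<union>
    (\<Union>l \<in> {l \<in> R. q < l \<and> card {x \<in> R. l < x} \<le> 1}.
       (#) (LNorth l) ` completions (R - {l}) (Suc h) l)"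
  proof (cases p)
    case Nil
    then show ?thesis using assms by (auto simp: completions_def)
  next
    case (Cons s p')
    then show ?thesis by (cases s) (auto simp: completions_def)
  qed
qed

text \<open>The completions are classified by their first step; different first steps give disjoint
  classes, and prepending a fixed step is injective.\<close>

lemma card_completions:
  assumes "finite R" "R \<noteq> {}"
  shows "card (completions R h q) =
    (if h = 0 then 0 else card (completions R (h - 1) 0)) +
    (\<Sum>l \<in> {l \<in> R. q < l \<and> card {x \<in> R. l < x} \<le> 1}. card (completions (R - {l}) (Suc h) l))"
proof -
  let ?L = "{l \<in> R. q < l \<and> card {x \<in> R. l < x} \<le> 1}"
  have "card (\<Union>l \<in> ?L. (#) (LNorth l) ` completions (R - {l}) (Suc h) l) =
      (\<Sum>l \<in> ?L. card ((#) (LNorth l) ` completions (R - {l}) (Suc h) l))"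
    using assms(1) by (intro card_UN_disjoint) (auto simp: finite_completions)
  also have "\<dots> = (\<Sum>l \<in> ?L. card (completions (R - {l}) (Suc h) l))"
    by (intro sum.cong refl card_image) simp
  finally have N: "card (\<Union>l \<in> ?L. (#) (LNorth l) ` completions (R - {l}) (Suc h) l) = \<dots>" .
  show ?thesis
    unfolding completions_unfold[OF assms(2), of h q] N[symmetric]
    by (subst card_Un_disjoint)
      (use assms(1) in \<open>auto simp: finite_completions card_image\<close>)
qed

lemma card_completions_empty: "card (completions {} h q) = 1"
proof -
  have "valid {} h q p \<longleftrightarrow> p = replicate h LEast" for p
  proof (induction p arbitrary: h q)
    case (Cons s p)
    then show ?case by (cases s; cases h) auto
  qed auto
  then show ?thesis by (simp add: completions_def)
qed

lemma card_completions_blocked: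
  assumes "finite R" "R \<noteq> {}" "\<And>x. x \<in> R \<Longrightarrow> x \<le> q"
  shows "card (completions R (Suc h) q) = card (completions R h 0)"
proof -
  have "{l \<in> R. q < l \<and> card {x \<in> R. l < x} \<le> 1} = {}"
    using assms(3) by force
  then show ?thesis
    using card_completions[OF assms(1,2), of "Suc h" q] by (simp only:) simp
qed

lemma card_completions_singleton:
  assumes "a > 0"
  shows "card (completions {a} h 0) = Suc h"
proof -
  have "{x \<in> {a}. a < x} = {}" by auto
  then have "card {x \<in> {a}. a < x} \<le> 1" by (simp only: card.empty)
  then have *: "{l \<in> {a}. 0 < l \<and> card {x \<in> {a}. l < x} \<le> 1} = {a}"
    using assms by blast
  show ?thesis
    by (induction h)
      (subst card_completions, simp, simp, simp only: *, simp add: card_completions_empty)+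
qed

lemma card_completions_two_largest:
  assumes R: "finite R" "R = insert a (insert c S)" and S: "\<And>x. x \<in> S \<Longrightarrow> x < c"
    and ca: "c < a" "0 < c"
  shows "card (completions R h 0) =
    (if h = 0 then 0 else card (completions R (h - 1) 0)) +
    card (completions (insert c S) h 0) + card (completions (insert a S) h 0) +
    card (completions S (Suc (Suc h)) a)"
proof -
  have finS: "finite S" using R by simp
  have notin: "a \<notin> S" "c \<notin> S" using S ca by (auto dest: S)
  have "\<not> card {x \<in> R. l < x} \<le> 1" if "l \<in> S" for l
  proof -
    have "{c, a} \<subseteq> {x \<in> R. l < x}" using R S[OF that] ca by auto
    then have "card {c, a} \<le> card {x \<in> R. l < x}" using R by (intro card_mono) auto
    then show ?thesis using ca by simp
  qed
  moreover have "{x \<in> R. a < x} = {}" "{x \<in> R. c < x} = {a}"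
    using R ca by (auto dest: S)
  then have "card {x \<in> R. a < x} \<le> 1" "card {x \<in> R. c < x} \<le> 1"
    by (simp_all only: card.empty is_singletonI[THEN is_singleton_altdef[THEN iffD1]])
  moreover have "l \<in> R \<longleftrightarrow> l = a \<or> l = c \<or> l \<in> S" for l
    using R by auto
  moreover have "0 < a" using ca by simp
  ultimately have top2: "{l \<in> R. 0 < l \<and> card {x \<in> R. l < x} \<le> 1} = {a, c}"
    using ca(2) by blast
  have "{x \<in> insert a S. a < x} = {}" using ca by (auto dest: S)
  then have "card {x \<in> insert a S. a < x} \<le> 1" by (simp only: card.empty)
  moreover have "\<not> c < l" if "l \<in> S" for l using S[OF that] by simp
  ultimately have top1: "{l \<in> insert a S. c < l \<and> card {x \<in> insert a S. l < x} \<le> 1} = {a}"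
    using ca(1) by blast
  have "card (completions (insert c S) (Suc h) a) = card (completions (insert c S) h 0)"
    using finS ca by (intro card_completions_blocked) (auto dest: S)
  moreover have "card (completions (insert a S) (Suc h) c) =
      card (completions (insert a S) h 0) + card (completions S (Suc (Suc h)) a)"
    using notin card_completions[of "insert a S" "Suc h" c, unfolded top1] finS by simp
  moreover have "R - {a} = insert c S" "R - {c} = insert a S"
    using R notin ca by auto
  ultimately show ?thesis
    using R ca card_completions[of R h 0, unfolded top2] by simp
qed

section \<open>The numbers \<open>b(n,k)\<close>\<close>

lemma b_eq_0: "k < 2 \<Longrightarrow> b n k = 0"
  by (subst b.simps) simp

lemma b_rec:
  assumes "m \<ge> 3" "2 \<le> k" "k \<le> int m + 1"
  shows "b m k = 2 * b (m - 1) (k - 1) + (\<Sum>j = k - 1..int m - 1. b (m - 2) j)"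
  using assms by (subst b.simps) simp

lemma b_sum_rec:
  assumes m: "m \<ge> 3"
  shows "(\<Sum>k = 2..int m + 1. b m k * w k) =
    2 * (\<Sum>j = 2..int (m - 1) + 1. b (m - 1) j * w (j + 1)) +
    (\<Sum>j = 2..int (m - 2) + 1. b (m - 2) j * (\<Sum>k = 2..j + 1. w k))"
proof -
  have "(\<Sum>k = 2..int m + 1. b m k * w k) =
      2 * (\<Sum>k = 2..int m + 1. b (m - 1) (k - 1) * w k) +
      (\<Sum>k = 2..int m + 1. \<Sum>j = k - 1..int m - 1. b (m - 2) j * w k)"
    using m by (simp add: b_rec algebra_simps sum.distrib sum_distrib_left sum_distrib_right)
  also have "(\<Sum>k = 2..int m + 1. b (m - 1) (k - 1) * w k) =
      (\<Sum>j = 1..int m. b (m - 1) j * w (j + 1))"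
    by (rule sum.reindex_bij_witness[of _ "\<lambda>j. j + 1" "\<lambda>k. k - 1"]) auto
  also have "\<dots> = (\<Sum>j = 2..int (m - 1) + 1. b (m - 1) j * w (j + 1))"
    using m by (intro sum.mono_neutral_right) (auto simp: b_eq_0)
  also have "(\<Sum>k = 2..int m + 1. \<Sum>j = k - 1..int m - 1. b (m - 2) j * w k) =
      (\<Sum>j = 1..int m - 1. \<Sum>k = 2..j + 1. b (m - 2) j * w k)"
    unfolding sum.Sigma[OF finite_atLeastAtMost_int ballI[OF finite_atLeastAtMost_int]]
    by (rule sum.reindex_bij_witness[of _ prod.swap prod.swap]) auto
  also have "\<dots> = (\<Sum>j = 2..int (m - 2) + 1. \<Sum>k = 2..j + 1. b (m - 2) j * w k)"
    using m by (intro sum.mono_neutral_right) (auto simp: b_eq_0)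
  finally show ?thesis by (simp add: sum_distrib_left)
qed

definition W :: "nat \<Rightarrow> nat \<Rightarrow> int" where
  "W m h = (\<Sum>k = 2..int m + 1. b m k * int (h + nat k - 1 choose h))"

lemma hockey_stick:
  "(\<Sum>k = 2..int j + 1. int (h + nat k - 2 choose h)) = int (h + j choose Suc h)"
proof (induction j)
  case (Suc j)
  have "{2..int (Suc j) + 1} = insert (int j + 2) {2..int j + 1}" by auto
  with Suc show ?case by (simp add: nat_add_distrib)
qed simp

lemma W_diff:
  assumes "m \<ge> 3"
  shows "(\<Sum>k = 2..int m + 1. b m k * int (h + nat k - 2 choose h)) =
    2 * W (m - 1) h + W (m - 2) (Suc h)"
proof -
  have 1: "h + nat (j + 1) - 2 = h + nat j - 1" if "j \<ge> 2" for j
    using that by (simp add: nat_add_distrib)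
  have 2: "(\<Sum>k = 2..j + 1. int (h + nat k - 2 choose h)) = int (Suc h + nat j - 1 choose Suc h)"
    if "j \<ge> 2" for j
    using hockey_stick[where j = "nat j" and h = h] that by simp
  show ?thesis
    unfolding b_sum_rec[OF assms] W_def
    by (intro arg_cong2[of _ _ _ _ "(+)"] arg_cong[of _ _ "(*) 2"] sum.cong refl) (simp_all only: atLeastAtMost_iff 1 2)
qed

lemma W_rec:
  assumes "m \<ge> 3"
  shows "W m h = (if h = 0 then 0 else W m (h - 1)) + 2 * W (m - 1) h + W (m - 2) (Suc h)"
proof (cases h)
  case 0
  then show ?thesis using W_diff[OF assms, of 0] by (simp add: W_def)
next
  case (Suc h')
  have "Suc h' + nat k - 1 choose Suc h' =
      (h' + nat k - 1 choose h') + (Suc h' + nat k - 2 choose Suc h')" if "k \<ge> 2" for k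
  proof -
    have "Suc h' + nat k - 1 = Suc (h' + nat k - 1)" "Suc h' + nat k - 2 = h' + nat k - 1"
      using that by linarith+
    then show ?thesis by (simp only: binomial_Suc_Suc)
  qed
  then have "W m (Suc h') = W m h' +
      (\<Sum>k = 2..int m + 1. b m k * int (Suc h' + nat k - 2 choose Suc h'))"
    unfolding W_def sum.distrib[symmetric] by (intro sum.cong refl) (simp add: algebra_simps)
  then show ?thesis using W_diff[OF assms, of "Suc h'"] Suc by simp
qed

lemma W_1: "W 1 h = 1 + int h"
proof -
  have "b 1 2 = 1" by (subst b.simps) simp
  then show ?thesis by (simp add: W_def)
qed

lemma W_2: "W 2 h = (int h + 1) + (int h + 2) * (int h + 1)"
proof -
  have "b 2 2 = 1" "b 2 3 = 2" by (simp_all add: b.simps)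
  moreover have "{2..int 2 + 1} = {2, 3}" by auto
  moreover have "2 * (h + 2 choose h) = (h + 2) * (h + 1)"
    by (induction h) (auto simp: algebra_simps)
  then have "2 * int (h + 2 choose h) = (int h + 2) * (int h + 1)"
    by (metis (no_types) of_nat_mult of_nat_add of_nat_1 of_nat_numeral)
  ultimately show ?thesis by (simp add: W_def)
qed

lemma card_completions_eq_W:
  assumes "finite R" "R \<noteq> {}" "0 \<notin> R"
  shows "int (card (completions R h 0)) = W (card R) h"
  using assms
proof (induction "2 * card R + h" arbitrary: R h rule: less_induct)
  case less
  define a where "a = Max R"
  have a: "a \<in> R" "\<And>x. x \<in> R \<Longrightarrow> x \<le> a" using less.prems by (auto simp: a_def)
  have "a > 0" using a(1) less.prems(3) by (cases a) auto
  show ?case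
  proof (cases "R = {a}")
    case True
    have "card R = 1" by (subst True) simp
    then show ?thesis using card_completions_singleton[OF \<open>a > 0\<close>, of h] True W_1[of h] by simp
  next
    case False
    define c where "c = Max (R - {a})"
    have ne: "R - {a} \<noteq> {}" using False a(1) by auto
    have c: "c \<in> R - {a}" "\<And>x. x \<in> R - {a} \<Longrightarrow> x \<le> c"
      using Max_in[OF _ ne] Max_ge[of "R - {a}"] less.prems(1) by (auto simp: c_def)
    define S where "S = R - {a, c}"
    have R: "R = insert a (insert c S)" using a c by (auto simp: S_def)
    have S: "x < c" if "x \<in> S" for x using c(2)[of x] that by (auto simp: S_def)
    have ca: "c < a" using a(2)[of c] c(1) by auto
    have "c > 0" using c(1) less.prems(3) by (cases c) auto
    have fin: "finite S" and "0 \<notin> S" using less.prems by (auto simp: S_def)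
    have notin: "a \<notin> S" "c \<notin> S" by (auto simp: S_def)
    have cardR: "card R = card S + 2" using fin notin ca by (simp add: R)
    have "int (card (completions R h 0)) = (if h = 0 then 0 else W (card R) (h - 1)) +
        2 * W (card R - 1) h + int (card (completions S (Suc (Suc h)) a))"
    proof -
      have "int (card (completions (insert c S) h 0)) = W (card R - 1) h"
        using less.hyps[of "insert c S" h] fin notin cardR \<open>c > 0\<close> \<open>0 \<notin> S\<close> by simp
      moreover have "int (card (completions (insert a S) h 0)) = W (card R - 1) h"
        using less.hyps[of "insert a S" h] fin notin cardR \<open>a > 0\<close> \<open>0 \<notin> S\<close> by simp
      moreover have "int (card (completions R (h - 1) 0)) = W (card R) (h - 1)" if "h \<noteq> 0"
        using less.hyps[of R "h - 1"] less.prems that by simp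
      ultimately show ?thesis
        using card_completions_two_largest[OF less.prems(1) R S ca \<open>c > 0\<close>, of h] by simp
    qed
    also have "\<dots> = W (card R) h"
    proof (cases "S = {}")
      case True
      have "W 2 h = (if h = 0 then 0 else W 2 (h - 1)) + 2 * W 1 h + 1"
        by (cases h) (simp_all add: W_1 W_2 algebra_simps del: One_nat_def)
      moreover have "card R = 2" using True cardR by simp
      ultimately show ?thesis
        by (simp add: True card_completions_empty)
    next
      case False
      have "card (completions S (Suc (Suc h)) a) = card (completions S (Suc h) 0)"
        using False fin S ca by (intro card_completions_blocked) (auto dest: S)
      moreover have "int (card (completions S (Suc h) 0)) = W (card R - 2) (Suc h)"
        using less.hyps[of S "Suc h"] fin False cardR \<open>0 \<notin> S\<close> by simp
      moreover have "card R \<ge> 3" using cardR fin False by (simp add: Suc_leI card_gt_0_iff)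
      ultimately show ?thesis using W_rec[of "card R" h] by simp
    qed
    finally show ?thesis .
  qed
qed

theorem theorem20:
  fixes n :: nat
  assumes "n \<ge> 1"
  shows "int (pf n [[1, 2, 3], [1, 3, 2]]) = (\<Sum>k = 2..int n + 1. b n k)"
proof -
  have "pf n [[1, 2, 3], [1, 3, 2]] = card (completions {1..n} 0 0)"
    using parking_function_avoiding_iff[of n] by (simp add: pf_def completions_def)
  moreover have "int (card (completions {1..n} 0 0)) = W n 0"
    using card_completions_eq_W[of "{1..n}" 0] assms by simp
  ultimately show ?thesis by (simp add: W_def)
qed

end
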